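(* In the bifurcating autoregressive (BAR) model, assume that the distribution $\nu$ of the ancestor $X_1$ has finite moments of all orders. Then $(\hat\theta^r,r\in\mathbb N)$ is a strongly consistent estimator of $\theta=(\alpha_0,\beta_0,\alpha_1,\beta_1)$, i.e. $\hat\theta^r\to\theta$ almost surely as $r\to\infty$.
   Context: Tree. $\mathbb T=\mathbb N^*=\{1,2,\dots\}$ is the binary tree (vertex $n$ has daughters $2n$, $2n+1$); $\mathbb T_r=\{1,\dots,2^{r+1}-1\}$ is the set of the first $r+1$ generations. BAR model. $X_1$ has distribution $\nu$ on $\mathbb R$ and for all $n\ge1$, $$X_{2n}=\alpha_0X_n+\beta_0+\varepsilon_{2n},\qquad X_{2n+1}=\alpha_1X_n+\beta_1+\varepsilon_{2n+1},$$ where $\alpha_0,\alpha_1\in(-1,1)$, $\beta_0,\beta_1\in\mathbb R$, and $((\varepsilon_{2n},\varepsilon_{2n+1}),n\ge1)$ is a sequence, independent of $X_1$, of i.i.d. centered bivariate Gaussian vectors with covariance matrix $\sigma^2\begin{pmatrix}1&\rho\\\rho&1\end{pmatrix}$, $\sigma^2>0$, $\rho\in(-1,1)$. Estimator. $\hat\theta^r=(\hat\alpha_0^r,\hat\beta_0^r,\hat\alpha_1^r,\hat\beta_1^r)$ with, for $\varepsilon\in\{0,1\}$, $$\hat\alpha_\varepsilon^r=\frac{|\mathbb T_r|^{-1}\sum_{i\in\mathbb T_r}X_iX_{2i+\varepsilon}-\big(|\mathbb T_r|^{-1}\sum_{i\in\mathbb T_r}X_i\big)\big(|\mathbb T_r|^{-1}\sum_{i\in\mathbb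 T_r}X_{2i+\varepsilon}\big)}{|\mathbb T_r|^{-1}\sum_{i\in\mathbb T_r}X_i^2-\big(|\mathbb T_r|^{-1}\sum_{i\in\mathbb T_r}X_i\big)^2},$$ $$\hat\beta_\varepsilon^r=|\mathbb T_r|^{-1}\sum_{i\in\mathbb T_r}X_{2i+\varepsilon}-\hat\alpha_\varepsilon^r|\mathbb T_r|^{-1}\sum_{i\in\mathbb T_r}X_i$$ (defined when the denominator is nonzero, arbitrary otherwise). *)

theory Defs
  imports "HOL-Probability.Probability"
begin

text \<open>The density on the plane of the centered Gaussian law with covariance matrix
  \<open>\<sigma>\<^sup>2 * (1, \<rho>; \<rho>, 1)\<close>.  The determinant of that matrix is \<open>\<sigma>\<^sup>4 * (1 - \<rho>\<^sup>2)\<close> and its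
  inverse is \<open>(1, -\<rho>; -\<rho>, 1) / (\<sigma>\<^sup>2 * (1 - \<rho>\<^sup>2))\<close>.\<close>

definition bivariate_normal_density :: "real \<Rightarrow> real \<Rightarrow> real \<times> real \<Rightarrow> real" where
  "bivariate_normal_density \<sigma> \<rho> = (\<lambda>(x, y).
     1 / (2 * pi * \<sigma>\<^sup>2 * sqrt (1 - \<rho>\<^sup>2)) *
     exp (- (x\<^sup>2 - 2 * \<rho> * x * y + y\<^sup>2) / (2 * \<sigma>\<^sup>2 * (1 - \<rho>\<^sup>2))))"

text \<open>Consistency check: the first coordinate is centered normal with variance \<open>\<sigma>\<^sup>2\<close>, and given
  that it equals \<open>x\<close>, the second one is normal with mean \<open>\<rho> * x\<close> and variance
  \<open>\<sigma>\<^sup>2 * (1 - \<rho>\<^sup>2)\<close>.\<close>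

lemma bivariate_normal_density_eq:
  assumes "\<sigma>\<^sup>2 > 0" "\<bar>\<rho>\<bar> < 1"
  shows "bivariate_normal_density \<sigma> \<rho> (x, y) =
    normal_density 0 \<sigma> x * normal_density (\<rho> * x) (\<sigma> * sqrt (1 - \<rho>\<^sup>2)) y"
proof -
  have r: "1 - \<rho>\<^sup>2 > 0"
    using assms(2) by (simp add: abs_square_less_1)
  have "sqrt (2 * pi * \<sigma>\<^sup>2) * sqrt (2 * pi * (\<sigma>\<^sup>2 * (1 - \<rho>\<^sup>2)))
      = sqrt ((2 * pi * \<sigma>\<^sup>2)\<^sup>2 * (1 - \<rho>\<^sup>2))"
    by (simp only: real_sqrt_mult [symmetric]) (simp add: power2_eq_square algebra_simps)
  also have "\<dots> = 2 * pi * \<sigma>\<^sup>2 * sqrt (1 - \<rho>\<^sup>2)"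
    by (simp add: real_sqrt_mult)
  finally have c: "sqrt (2 * pi * \<sigma>\<^sup>2) * sqrt (2 * pi * (\<sigma>\<^sup>2 * (1 - \<rho>\<^sup>2)))
      = 2 * pi * \<sigma>\<^sup>2 * sqrt (1 - \<rho>\<^sup>2)" .
  have v: "(\<sigma> * sqrt (1 - \<rho>\<^sup>2))\<^sup>2 = \<sigma>\<^sup>2 * (1 - \<rho>\<^sup>2)"
    using r by (simp add: power_mult_distrib)
  have "- (x\<^sup>2 - 2 * \<rho> * x * y + y\<^sup>2) / (2 * \<sigma>\<^sup>2 * (1 - \<rho>\<^sup>2))
      = - (x\<^sup>2 * (1 - \<rho>\<^sup>2) + (y - \<rho> * x)\<^sup>2) / (2 * \<sigma>\<^sup>2 * (1 - \<rho>\<^sup>2))"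
    by (simp add: power2_eq_square algebra_simps)
  also have "\<dots> = - x\<^sup>2 / (2 * \<sigma>\<^sup>2) - (y - \<rho> * x)\<^sup>2 / (2 * (\<sigma>\<^sup>2 * (1 - \<rho>\<^sup>2)))"
  proof -
    have "- (a * q + b) / (2 * s * q) = - a / (2 * s) - b / (2 * (s * q))"
      if "s > 0" "q > 0" for a b s q :: real
      using that by (simp add: field_simps)
    then show ?thesis
      using assms(1) r by blast
  qed
  finally have e: "- (x\<^sup>2 - 2 * \<rho> * x * y + y\<^sup>2) / (2 * \<sigma>\<^sup>2 * (1 - \<rho>\<^sup>2))
      = - x\<^sup>2 / (2 * \<sigma>\<^sup>2) + - (y - \<rho> * x)\<^sup>2 / (2 * (\<sigma>\<^sup>2 * (1 - \<rho>\<^sup>2)))"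
    by simp
  show ?thesis
    unfolding bivariate_normal_density_def normal_density_def prod.case v e exp_add c [symmetric]
    by simp
qed

text \<open>The library constant \<open>indep_var\<close> requires both variables to take values in the same type.\<close>

definition (in prob_space) indep_rv ::
    "'b measure \<Rightarrow> ('a \<Rightarrow> 'b) \<Rightarrow> 'c measure \<Rightarrow> ('a \<Rightarrow> 'c) \<Rightarrow> bool" where
  "indep_rv N Y N' Z \<longleftrightarrow> random_variable N Y \<and> random_variable N' Z \<and>
     indep_set {Y -` A \<inter> space M | A. A \<in> sets N} {Z -` B \<inter> space M | B. B \<in> sets N'}"

text \<open>Almost sure equalities suffice for the recursion; identical distribution of the noise pairs is
  part of \<open>noise_gaussian\<close>, whose density does not depend on \<open>n\<close>.\<close>

locale bar_model = prob_space M
  for M :: "'a measure" +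
  fixes \<nu> :: "real measure"
    and \<alpha>0 \<beta>0 \<alpha>1 \<beta>1 \<sigma> \<rho> :: real
    and X \<epsilon> :: "nat \<Rightarrow> 'a \<Rightarrow> real"
  assumes alpha0: "-1 < \<alpha>0" "\<alpha>0 < 1"
    and alpha1: "-1 < \<alpha>1" "\<alpha>1 < 1"
    and sigma: "\<sigma>\<^sup>2 > 0"
    and rho: "-1 < \<rho>" "\<rho> < 1"
    and X_rv: "\<And>n. n \<ge> 1 \<Longrightarrow> random_variable borel (X n)"
    and X_1: "distr M borel (X 1) = \<nu>"
    and X_even: "\<And>n. n \<ge> 1 \<Longrightarrow>
      AE \<omega> in M. X (2 * n) \<omega> = \<alpha>0 * X n \<omega> + \<beta>0 + \<epsilon> (2 * n) \<omega>"
    and X_odd: "\<And>n. n \<ge> 1 \<Longrightarrow>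
      AE \<omega> in M. X (2 * n + 1) \<omega> = \<alpha>1 * X n \<omega> + \<beta>1 + \<epsilon> (2 * n + 1) \<omega>"
    and noise_gaussian: "\<And>n. n \<ge> 1 \<Longrightarrow>
      distributed M lborel (\<lambda>\<omega>. (\<epsilon> (2 * n) \<omega>, \<epsilon> (2 * n + 1) \<omega>))
        (\<lambda>z. ennreal (bivariate_normal_density \<sigma> \<rho> z))"
    and noise_indep:
      "indep_vars (\<lambda>_. borel) (\<lambda>n \<omega>. (\<epsilon> (2 * n) \<omega>, \<epsilon> (2 * n + 1) \<omega>)) {1..}"
    and noise_indep_X_1:
      "indep_rv borel (X 1)
         (Pi\<^sub>M {1..} (\<lambda>_. borel)) (\<lambda>\<omega>. \<lambda>n\<in>{1..}. (\<epsilon> (2 * n) \<omega>, \<epsilon> (2 * n + 1) \<omega>))"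

text \<open>The estimator is a function of the observed values \<open>x\<close> on the tree.  When its denominator
  vanishes (as it always does for \<open>r = 0\<close>), it takes the value \<open>d\<close>, which is left arbitrary.\<close>

definition tree_upto :: "nat \<Rightarrow> nat set" where
  "tree_upto r = {1..2 ^ (r + 1) - 1}"

definition tree_mean :: "nat \<Rightarrow> (nat \<Rightarrow> real) \<Rightarrow> real" where
  "tree_mean r f = (\<Sum>i\<in>tree_upto r. f i) / real (card (tree_upto r))"

definition estim_denom :: "nat \<Rightarrow> (nat \<Rightarrow> real) \<Rightarrow> real" where
  "estim_denom r x = tree_mean r (\<lambda>i. (x i)\<^sup>2) - (tree_mean r x)\<^sup>2"

definition alpha_hat :: "nat \<Rightarrow> nat \<Rightarrow> (nat \<Rightarrow> real) \<Rightarrow> real" where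
  "alpha_hat e r x =
     (tree_mean r (\<lambda>i. x i * x (2 * i + e)) - tree_mean r x * tree_mean r (\<lambda>i. x (2 * i + e)))
     / estim_denom r x"

definition beta_hat :: "nat \<Rightarrow> nat \<Rightarrow> (nat \<Rightarrow> real) \<Rightarrow> real" where
  "beta_hat e r x = tree_mean r (\<lambda>i. x (2 * i + e)) - alpha_hat e r x * tree_mean r x"

definition theta_hat ::
    "real \<times> real \<times> real \<times> real \<Rightarrow> nat \<Rightarrow> (nat \<Rightarrow> real) \<Rightarrow> real \<times> real \<times> real \<times> real" where
  "theta_hat d r x =
     (if estim_denom r x \<noteq> 0
      then (alpha_hat 0 r x, beta_hat 0 r x, alpha_hat 1 r x, beta_hat 1 r x) else d)"

end

theory Submission
  imports Defs
begin

text \<open>Substituting the recursion into the estimator, the error \<open>\<alpha>\<^sub>e_hat - \<alpha>\<^sub>e\<close> becomes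
  \<open>(mean(X \<epsilon>\<^sub>e) - mean(X) mean(\<epsilon>\<^sub>e)) / (mean(X\<^sup>2) - mean(X)\<^sup>2)\<close>, where \<open>mean\<close> averages over the tree
  and \<open>\<epsilon>\<^sub>e\<close> is the noise of the daughter of type \<open>e\<close>.  The variables \<open>\<epsilon>\<^sub>e\<close>, \<open>\<epsilon>\<^sub>e\<^sup>2 - \<sigma>\<^sup>2\<close> and \<open>X \<epsilon>\<^sub>e\<close>
  indexed by the vertices are orthogonal and bounded in \<open>L\<^sup>2\<close>.  Since the trees grow geometrically,
  the second moments of their means are summable in \<open>r\<close>, so these means converge to \<open>0\<close> almost surely
  without any appeal to ergodicity.  The means of \<open>X\<close> and \<open>X\<^sup>2\<close> then satisfy, pathwise, contracting
  affine recursions in \<open>r\<close> with convergent coefficients; hence they converge, and by convexity the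
  limit \<open>q - \<mu>\<^sup>2\<close> of the denominator is bounded below by a positive multiple of \<open>\<sigma>\<^sup>2\<close>.\<close>

section \<open>Averages over the binary tree\<close>

text \<open>Once the perturbation is below \<open>(\<eta> / 2) * (1 - q)\<close>, the part of
  \<open>e\<close> exceeding \<open>\<eta> / 2\<close> shrinks by the factor \<open>q\<close> at
  each step. The inequality is required only eventually, because coefficients that merely converge
  stay below \<open>q\<close> only from some index on.\<close>

lemma contraction_tendsto_0:
  fixes e \<delta> :: "nat \<Rightarrow> real"
  assumes nonneg: "\<And>n. 0 \<le> e n" and q: "0 \<le> q" "q < 1"
    and step: "\<forall>\<^sub>F n in sequentially. e (Suc n) \<le> q * e n + \<delta> n"
    and \<delta>: "\<delta> \<longlonglongrightarrow> 0"
  shows "e \<longlonglongrightarrow> 0"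
proof (rule LIMSEQ_I)
  fix \<eta> :: real assume \<eta>: "0 < \<eta>"
  \<comment> \<open>This bound makes \<open>\<eta> / 2\<close> the fixed point of the majorizing
    affine map of slope \<open>q\<close>.\<close>
  have "\<forall>\<^sub>F n in sequentially. \<delta> n < (\<eta> / 2) * (1 - q)"
    using q \<eta> by (intro order_tendstoD(2)[OF \<delta>]) auto
  with step have "\<forall>\<^sub>F n in sequentially. e (Suc n) \<le> q * e n + (\<eta> / 2) * (1 - q)"
    by eventually_elim simp
  then obtain R where R: "\<And>n. n \<ge> R \<Longrightarrow> e (Suc n) \<le> q * e n + (\<eta> / 2) * (1 - q)"
    by (auto simp: eventually_sequentially)
  \<comment> \<open>Cutting the excess off at 0 keeps the contraction valid after \<open>e\<close>
    has dropped below the level.\<close>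
  define g where "g n = max (e n - \<eta> / 2) 0" for n
  have g: "g (R + k) \<le> q ^ k * g R" for k
  proof (induction k)
    case (Suc k)
    have "e (Suc (R + k)) - \<eta> / 2 \<le> q * (e (R + k) - \<eta> / 2)"
      using R[of "R + k"] by (simp add: field_simps)
    also have "\<dots> \<le> q * g (R + k)"
      using q by (intro mult_left_mono) (auto simp: g_def)
    finally have "g (R + Suc k) \<le> q * g (R + k)"
      using q by (auto simp: g_def)
    also have "\<dots> \<le> q * (q ^ k * g R)"
      using q by (intro mult_left_mono Suc.IH)
    finally show ?case by simp
  qed simp
  have "(\<lambda>k. q ^ k * g R) \<longlonglongrightarrow> 0 * g R"
    using q by (intro tendsto_mult tendsto_const LIMSEQ_realpow_zero)
  then have "\<forall>\<^sub>F k in sequentially. q ^ k * g R < \<eta> / 2"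
    using \<eta> by (intro order_tendstoD(2)[where y = "0 * g R"]) auto
  then obtain K where K: "\<And>k. k \<ge> K \<Longrightarrow> q ^ k * g R < \<eta> / 2"
    by (auto simp: eventually_sequentially)
  show "\<exists>no. \<forall>n\<ge>no. norm (e n - 0) < \<eta>"
  proof (intro exI allI impI)
    fix n assume n: "n \<ge> R + K"
    have "g (R + (n - R)) < \<eta> / 2"
      using le_less_trans[OF g K[of "n - R"]] n by simp
    then show "norm (e n - 0) < \<eta>"
      using n nonneg[of n] by (auto simp: g_def max_def split: if_splits)
  qed
qed

text \<open>The distance to the fixed point \<open>L\<close> of the limiting map contracts: a factor
  \<open>q\<close> strictly between \<open>\<bar>A\<bar>\<close> and 1 dominates
  \<open>\<bar>a n\<bar>\<close> for large \<open>n\<close>, and the defect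
  \<open>a n * L + b n - L\<close> vanishes.\<close>

lemma affine_recursion_tendsto:
  fixes u a b :: "nat \<Rightarrow> real"
  assumes rec: "\<And>n. u (Suc n) = a n * u n + b n"
    and a: "a \<longlonglongrightarrow> A" and b: "b \<longlonglongrightarrow> B" and A: "\<bar>A\<bar> < 1"
  shows "u \<longlonglongrightarrow> B / (1 - A)"
proof -
  define L where "L = B / (1 - A)"
  have L: "A * L + B = L"
    using A by (auto simp: L_def field_simps)
  obtain q where q: "\<bar>A\<bar> < q" "q < 1"
    using A dense by blast
  have "(\<lambda>n. \<bar>u n - L\<bar>) \<longlonglongrightarrow> 0"
  proof (rule contraction_tendsto_0)
    have "(\<lambda>n. \<bar>a n\<bar>) \<longlonglongrightarrow> \<bar>A\<bar>"
      by (intro tendsto_intros a)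
    then have "\<forall>\<^sub>F n in sequentially. \<bar>a n\<bar> < q"
      using q by (intro order_tendstoD(2))
    then show "\<forall>\<^sub>F n in sequentially. \<bar>u (Suc n) - L\<bar> \<le> q * \<bar>u n - L\<bar> + \<bar>a n * L + b n - L\<bar>"
    proof eventually_elim
      case (elim n)
      have "u (Suc n) - L = a n * (u n - L) + (a n * L + b n - L)"
        by (simp add: rec algebra_simps)
      then have "\<bar>u (Suc n) - L\<bar> \<le> \<bar>a n\<bar> * \<bar>u n - L\<bar> + \<bar>a n * L + b n - L\<bar>"
        by (metis abs_triangle_ineq abs_mult)
      also have "\<bar>a n\<bar> * \<bar>u n - L\<bar> \<le> q * \<bar>u n - L\<bar>"
        using elim by (intro mult_right_mono) auto
      finally show ?case by simp
    qed
    have "(\<lambda>n. \<bar>a n * L + b n - L\<bar>) \<longlonglongrightarrow> \<bar>A * L + B - L\<bar>"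
      by (intro tendsto_intros a b)
    then show "(\<lambda>n. \<bar>a n * L + b n - L\<bar>) \<longlonglongrightarrow> 0"
      by (simp add: L)
  qed (use q in auto)
  then show ?thesis
    unfolding L_def[symmetric] tendsto_rabs_zero_iff by (simp add: LIM_zero_iff)
qed

section \<open>Sizes of the trees and the algebra of tree means\<close>

lemma card_tree_upto: "card (tree_upto r) = 2 ^ (r + 1) - 1"
  by (simp add: tree_upto_def)

lemma card_tree_upto_pos: "card (tree_upto r) > 0"
  \<comment> \<open>Splitting \<open>2 ^ r\<close> into zero and successor resolves the truncated
    subtraction.\<close>
  unfolding card_tree_upto by (cases "2 ^ r :: nat") simp_all

lemma card_tree_upto_Suc: "card (tree_upto (Suc r)) = 2 * card (tree_upto r) + 1"
  unfolding card_tree_upto by (cases "2 ^ r :: nat") simp_all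

lemma finite_tree_upto [simp]: "finite (tree_upto r)"
  by (simp add: tree_upto_def)

lemma sum_atLeastAtMost_double:
  fixes f :: "nat \<Rightarrow> 'b::comm_monoid_add"
  shows "(\<Sum>i = 1..2 * n + 1. f i) = f 1 + (\<Sum>i = 1..n. f (2 * i) + f (2 * i + 1))"
  by (induction n) (simp_all add: add.assoc)

text \<open>Every vertex except the root has exactly one mother, so adding a generation amounts to
  regrouping by mothers.\<close>

lemma sum_tree_upto_Suc:
  fixes f :: "nat \<Rightarrow> 'b::comm_monoid_add"
  shows "sum f (tree_upto (Suc r)) = f 1 + (\<Sum>i\<in>tree_upto r. f (2 * i) + f (2 * i + 1))"
proof -
  have "tree_upto (Suc r) = {1..2 * (2 ^ (r + 1) - 1) + 1}"
    unfolding tree_upto_def by (cases "2 ^ r :: nat") simp_all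
  then show ?thesis
    using sum_atLeastAtMost_double[of f "2 ^ (r + 1) - 1"] by (simp add: tree_upto_def)
qed

text \<open>The geometric growth of the trees, in the form that makes second moments of tree means
  summable.\<close>

lemma inverse_card_tree_upto_le: "1 / real (card (tree_upto r)) \<le> (1 / 2) ^ r"
proof -
  have "real (card (tree_upto r)) \<ge> 2 ^ r"
    unfolding card_tree_upto using one_le_power[of "2::real" r]
    by (simp add: of_nat_diff)
  then show ?thesis
    by (simp add: power_one_over frac_le)
qed

lemma inverse_card_tree_upto_tendsto: "(\<lambda>r. 1 / real (card (tree_upto r))) \<longlonglongrightarrow> 0"
proof (rule tendsto_sandwich[OF _ _ tendsto_const])
  show "\<forall>\<^sub>F r in sequentially. 1 / real (card (tree_upto r)) \<le> (1 / 2) ^ r"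
    by (simp add: inverse_card_tree_upto_le)
  show "(\<lambda>r. (1 / 2 :: real) ^ r) \<longlonglongrightarrow> 0"
    by (intro LIMSEQ_realpow_zero) auto
qed simp

text \<open>The weight with which the daughters of \<open>tree_upto r\<close> enter the mean over
  the next tree.\<close>

definition tree_ratio :: "nat \<Rightarrow> real" where
  "tree_ratio r = real (card (tree_upto r)) / real (card (tree_upto (Suc r)))"

lemma tree_ratio_tendsto: "tree_ratio \<longlonglongrightarrow> 1 / 2"
proof -
  have "c / (2 * c + 1) = 1 / (2 + 1 / c)" if "c > 0" for c :: real
    using that by (simp add: divide_simps add_pos_pos)
  then have "tree_ratio r = 1 / (2 + 1 / real (card (tree_upto r)))" for r
    using card_tree_upto_pos[of r]
    by (simp add: tree_ratio_def card_tree_upto_Suc add.commute)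
  then have "tree_ratio = (\<lambda>r. 1 / (2 + 1 / real (card (tree_upto r))))"
    by blast
  moreover have "(\<lambda>r. 1 / (2 + 1 / real (card (tree_upto r)))) \<longlonglongrightarrow> 1 / (2 + 0)"
    by (intro tendsto_intros inverse_card_tree_upto_tendsto) auto
  ultimately show ?thesis by simp
qed

lemma tree_mean_Suc:
  "tree_mean (Suc r) f = tree_ratio r * tree_mean r (\<lambda>i. f (2 * i) + f (2 * i + 1))
     + f 1 / real (card (tree_upto (Suc r)))"
  using card_tree_upto_pos[of r]
  by (simp add: tree_mean_def tree_ratio_def sum_tree_upto_Suc add_divide_distrib)

lemma tree_mean_add: "tree_mean r (\<lambda>i. f i + g i) = tree_mean r f + tree_mean r g"
  by (simp add: tree_mean_def sum.distrib add_divide_distrib)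

lemma tree_mean_mult: "tree_mean r (\<lambda>i. c * f i) = c * tree_mean r f"
  by (simp add: tree_mean_def sum_distrib_left)

lemma tree_mean_const: "tree_mean r (\<lambda>_. c) = c"
  using card_tree_upto_pos[of r] by (auto simp add: tree_mean_def)

lemma tree_mean_cong:
  "(\<And>i. i \<ge> 1 \<Longrightarrow> f i = g i) \<Longrightarrow> tree_mean r f = tree_mean r g"
  unfolding tree_mean_def by (intro arg_cong2[where f = "(/)"] sum.cong) (auto simp: tree_upto_def)

lemmas tree_mean_linear = tree_mean_add tree_mean_mult tree_mean_const

text \<open>The normalization by 2 makes \<open>A\<close> and \<open>g\<close> averages over the two
  daughters. It cancels against the limit 1/2 of \<open>tree_ratio\<close>, while the root
  contributes a vanishing term, so the limit is the fixed point of the affine map with coefficients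
  \<open>A\<close> and \<open>B\<close>.\<close>

lemma tree_mean_recursion_tendsto:
  fixes f :: "nat \<Rightarrow> real"
  assumes rec: "\<And>r. tree_mean r (\<lambda>i. f (2 * i) + f (2 * i + 1)) = 2 * A * tree_mean r f + 2 * g r"
    and g: "g \<longlonglongrightarrow> B" and A: "\<bar>A\<bar> < 1"
  shows "(\<lambda>r. tree_mean r f) \<longlonglongrightarrow> B / (1 - A)"
proof (rule affine_recursion_tendsto[OF _ _ _ A])
  show "tree_mean (Suc r) f = 2 * A * tree_ratio r * tree_mean r f
      + (2 * tree_ratio r * g r + f 1 * (1 / real (card (tree_upto (Suc r)))))" for r
    unfolding tree_mean_Suc rec by (simp add: algebra_simps)
  have "(\<lambda>r. 2 * A * tree_ratio r) \<longlonglongrightarrow> 2 * A * (1 / 2)"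
    by (intro tendsto_intros tree_ratio_tendsto)
  then show "(\<lambda>r. 2 * A * tree_ratio r) \<longlonglongrightarrow> A" by simp
  have "(\<lambda>r. 2 * tree_ratio r * g r + f 1 * (1 / real (card (tree_upto (Suc r)))))
      \<longlonglongrightarrow> 2 * (1 / 2) * B + f 1 * 0"
    by (intro tendsto_intros tree_ratio_tendsto g
        inverse_card_tree_upto_tendsto[THEN LIMSEQ_Suc])
  then show "(\<lambda>r. 2 * tree_ratio r * g r + f 1 * (1 / real (card (tree_upto (Suc r)))))
      \<longlonglongrightarrow> B" by simp
qed

section \<open>Deterministic autoregressive paths\<close>

text \<open>A single trajectory along which the laws of large numbers hold. It separates the
  deterministic part of the argument from the probabilistic one; \<open>s\<close> stands for the
  noise variance.\<close>

locale bar_path =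
  fixes \<alpha>0 \<beta>0 \<alpha>1 \<beta>1 s :: real and x \<eta> :: "nat \<Rightarrow> real"
  assumes \<alpha>0: "\<bar>\<alpha>0\<bar> < 1" and \<alpha>1: "\<bar>\<alpha>1\<bar> < 1" and s: "s > 0"
    and even: "\<And>n. n \<ge> 1 \<Longrightarrow> x (2 * n) = \<alpha>0 * x n + \<beta>0 + \<eta> (2 * n)"
    and odd: "\<And>n. n \<ge> 1 \<Longrightarrow> x (2 * n + 1) = \<alpha>1 * x n + \<beta>1 + \<eta> (2 * n + 1)"
    and noise: "\<And>e. e \<in> {0, 1} \<Longrightarrow> (\<lambda>r. tree_mean r (\<lambda>i. \<eta> (2 * i + e))) \<longlonglongrightarrow> 0"
    and noise_sq: "\<And>e. e \<in> {0, 1} \<Longrightarrow> (\<lambda>r. tree_mean r (\<lambda>i. (\<eta> (2 * i + e))\<^sup>2)) \<longlonglongrightarrow> s"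
    and cross: "\<And>e. e \<in> {0, 1} \<Longrightarrow> (\<lambda>r. tree_mean r (\<lambda>i. x i * \<eta> (2 * i + e))) \<longlonglongrightarrow> 0"
begin

text \<open>The stationary mean of the chain that moves to a daughter chosen by a fair coin.\<close>

definition \<mu> :: real where
  "\<mu> = ((\<beta>0 + \<beta>1) / 2) / (1 - (\<alpha>0 + \<alpha>1) / 2)"

text \<open>The stationary second moment of the same chain, with noise contribution
  \<open>s\<close>.\<close>

definition q :: real where
  "q = ((\<alpha>0 * \<beta>0 + \<alpha>1 * \<beta>1) * \<mu> + (\<beta>0\<^sup>2 + \<beta>1\<^sup>2) / 2 + s) / (1 - (\<alpha>0\<^sup>2 + \<alpha>1\<^sup>2) / 2)"

lemma tree_mean_tendsto: "(\<lambda>r. tree_mean r x) \<longlonglongrightarrow> \<mu>"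
  unfolding \<mu>_def
proof (rule tree_mean_recursion_tendsto)
  show "tree_mean r (\<lambda>i. x (2 * i) + x (2 * i + 1)) = 2 * ((\<alpha>0 + \<alpha>1) / 2) * tree_mean r x
      + 2 * ((\<beta>0 + \<beta>1) / 2 + (tree_mean r (\<lambda>i. \<eta> (2 * i)) + tree_mean r (\<lambda>i. \<eta> (2 * i + 1))) / 2)" for r
  proof -
    have "tree_mean r (\<lambda>i. x (2 * i) + x (2 * i + 1))
        = tree_mean r (\<lambda>i. (\<alpha>0 + \<alpha>1) * x i + ((\<beta>0 + \<beta>1) + (\<eta> (2 * i) + \<eta> (2 * i + 1))))"
      by (rule tree_mean_cong) (use even odd in \<open>simp add: algebra_simps\<close>)
    then show ?thesis by (simp only: tree_mean_linear) (simp add: field_simps)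
  qed
  have "(\<lambda>r. (\<beta>0 + \<beta>1) / 2 + (tree_mean r (\<lambda>i. \<eta> (2 * i)) + tree_mean r (\<lambda>i. \<eta> (2 * i + 1))) / 2)
     \<longlonglongrightarrow> (\<beta>0 + \<beta>1) / 2 + (0 + 0) / 2"
    using noise[of 0] noise[of 1] by (intro tendsto_intros) auto
  then show "(\<lambda>r. (\<beta>0 + \<beta>1) / 2 + (tree_mean r (\<lambda>i. \<eta> (2 * i)) + tree_mean r (\<lambda>i. \<eta> (2 * i + 1))) / 2)
     \<longlonglongrightarrow> (\<beta>0 + \<beta>1) / 2" by simp
  show "\<bar>(\<alpha>0 + \<alpha>1) / 2\<bar> < 1" using \<alpha>0 \<alpha>1 by (simp add: abs_less_iff)
qed

lemma mean_alpha_sq: "(\<alpha>0\<^sup>2 + \<alpha>1\<^sup>2) / 2 < 1"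
  using \<alpha>0 \<alpha>1 abs_square_less_1[of \<alpha>0] abs_square_less_1[of \<alpha>1] by simp

text \<open>Expanding the squared recursion gives a contracting recursion for the mean square. The
  inhomogeneous part involves the mean of \<open>x\<close>, whose limit is already known, and noise
  averages with assumed limits.\<close>

lemma tree_mean_sq_tendsto: "(\<lambda>r. tree_mean r (\<lambda>i. (x i)\<^sup>2)) \<longlonglongrightarrow> q"
  unfolding q_def
proof (rule tree_mean_recursion_tendsto)
  define g where "g r = (\<alpha>0 * \<beta>0 + \<alpha>1 * \<beta>1) * tree_mean r x + (\<beta>0\<^sup>2 + \<beta>1\<^sup>2) / 2
      + (tree_mean r (\<lambda>i. (\<eta> (2 * i))\<^sup>2) + tree_mean r (\<lambda>i. (\<eta> (2 * i + 1))\<^sup>2)) / 2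
      + \<alpha>0 * tree_mean r (\<lambda>i. x i * \<eta> (2 * i)) + \<alpha>1 * tree_mean r (\<lambda>i. x i * \<eta> (2 * i + 1))
      + \<beta>0 * tree_mean r (\<lambda>i. \<eta> (2 * i)) + \<beta>1 * tree_mean r (\<lambda>i. \<eta> (2 * i + 1))" for r
  show "tree_mean r (\<lambda>i. (x (2 * i))\<^sup>2 + (x (2 * i + 1))\<^sup>2)
     = 2 * ((\<alpha>0\<^sup>2 + \<alpha>1\<^sup>2) / 2) * tree_mean r (\<lambda>i. (x i)\<^sup>2) + 2 * g r" for r
  proof -
    have "tree_mean r (\<lambda>i. (x (2 * i))\<^sup>2 + (x (2 * i + 1))\<^sup>2)
        = tree_mean r (\<lambda>i. (\<alpha>0\<^sup>2 + \<alpha>1\<^sup>2) * (x i)\<^sup>2 + (2 * (\<alpha>0 * \<beta>0 + \<alpha>1 * \<beta>1)) * x i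
          + (\<beta>0\<^sup>2 + \<beta>1\<^sup>2) + (\<eta> (2 * i))\<^sup>2 + (\<eta> (2 * i + 1))\<^sup>2
          + (2 * \<alpha>0) * (x i * \<eta> (2 * i)) + (2 * \<alpha>1) * (x i * \<eta> (2 * i + 1))
          + (2 * \<beta>0) * \<eta> (2 * i) + (2 * \<beta>1) * \<eta> (2 * i + 1))"
      by (rule tree_mean_cong) (use even odd in \<open>simp add: power2_eq_square algebra_simps\<close>)
    then show ?thesis by (simp only: tree_mean_linear g_def) (simp add: field_simps)
  qed
  have "g \<longlonglongrightarrow> (\<alpha>0 * \<beta>0 + \<alpha>1 * \<beta>1) * \<mu> + (\<beta>0\<^sup>2 + \<beta>1\<^sup>2) / 2 + (s + s) / 2
      + \<alpha>0 * 0 + \<alpha>1 * 0 + \<beta>0 * 0 + \<beta>1 * 0"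
    unfolding g_def
    using noise[of 0] noise[of 1] noise_sq[of 0] noise_sq[of 1] cross[of 0] cross[of 1]
    by (intro tendsto_intros tree_mean_tendsto) auto
  then show "g \<longlonglongrightarrow> (\<alpha>0 * \<beta>0 + \<alpha>1 * \<beta>1) * \<mu> + (\<beta>0\<^sup>2 + \<beta>1\<^sup>2) / 2 + s" by simp
  show "\<bar>(\<alpha>0\<^sup>2 + \<alpha>1\<^sup>2) / 2\<bar> < 1" using mean_alpha_sq by simp
qed

text \<open>By convexity, \<open>\<mu>\<^sup>2\<close> satisfies as an inequality the second-moment
  equation without the term \<open>s\<close>. Subtracting it from the equation for \<open>q\<close>
  gives \<open>(q - \<mu>\<^sup>2) * (1 - A) \<ge> s\<close>.\<close>

lemma limit_variance_pos: "q - \<mu>\<^sup>2 > 0"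
proof -
  define A where "A = (\<alpha>0\<^sup>2 + \<alpha>1\<^sup>2) / 2"
  have A: "A < 1" using mean_alpha_sq by (simp add: A_def)
  have "1 - (\<alpha>0 + \<alpha>1) / 2 \<noteq> 0" using \<alpha>0 \<alpha>1 by (simp add: abs_less_iff)
  from nonzero_divide_eq_eq[THEN iffD1, OF this \<mu>_def[symmetric]]
  have "\<mu> * (1 - (\<alpha>0 + \<alpha>1) / 2) = (\<beta>0 + \<beta>1) / 2" ..
  then have \<mu>: "\<mu> = ((\<alpha>0 * \<mu> + \<beta>0) + (\<alpha>1 * \<mu> + \<beta>1)) / 2"
    by (simp add: field_simps)
  have q: "q * (1 - A) = (\<alpha>0 * \<beta>0 + \<alpha>1 * \<beta>1) * \<mu> + (\<beta>0\<^sup>2 + \<beta>1\<^sup>2) / 2 + s"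
    using A by (simp add: q_def A_def)
  have "\<mu>\<^sup>2 = (((\<alpha>0 * \<mu> + \<beta>0) + (\<alpha>1 * \<mu> + \<beta>1)) / 2)\<^sup>2"
    by (rule arg_cong[OF \<mu>])
  \<comment> \<open>The two sides differ by a quarter of the squared difference of the two
    terms.\<close>
  also have "\<dots> \<le> ((\<alpha>0 * \<mu> + \<beta>0)\<^sup>2 + (\<alpha>1 * \<mu> + \<beta>1)\<^sup>2) / 2"
    using zero_le_power2[of "(\<alpha>0 * \<mu> + \<beta>0) - (\<alpha>1 * \<mu> + \<beta>1)"]
    unfolding power2_sum power2_diff power_divide by (simp add: power2_eq_square algebra_simps)
  also have "\<dots> = A * \<mu>\<^sup>2 + (\<alpha>0 * \<beta>0 + \<alpha>1 * \<beta>1) * \<mu> + (\<beta>0\<^sup>2 + \<beta>1\<^sup>2) / 2"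
    by (simp add: A_def power2_eq_square field_simps)
  finally have "(q - \<mu>\<^sup>2) * (1 - A) \<ge> s"
    using q by (simp add: algebra_simps)
  with s have "(q - \<mu>\<^sup>2) * (1 - A) > 0" by linarith
  with A show ?thesis by (simp add: zero_less_mult_iff)
qed

lemma estim_denom_tendsto: "(\<lambda>r. estim_denom r x) \<longlonglongrightarrow> q - \<mu>\<^sup>2"
  unfolding estim_denom_def by (intro tendsto_intros tree_mean_tendsto tree_mean_sq_tendsto)

lemma estim_denom_nonzero: "\<forall>\<^sub>F r in sequentially. estim_denom r x \<noteq> 0"
  using order_tendstoD(1)[OF estim_denom_tendsto limit_variance_pos]
  by eventually_elim simp

text \<open>A generic type \<open>e\<close> lets both daughters share one proof. The intercept
  estimator inherits its limit from the slope estimator.\<close>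

lemma estimators_tendsto:
  assumes e: "e \<in> {0, 1}" and rec: "\<And>n. n \<ge> 1 \<Longrightarrow> x (2 * n + e) = \<alpha> * x n + \<beta> + \<eta> (2 * n + e)"
  shows "(\<lambda>r. alpha_hat e r x) \<longlonglongrightarrow> \<alpha>" and "(\<lambda>r. beta_hat e r x) \<longlonglongrightarrow> \<beta>"
proof -
  define c where "c r = tree_mean r (\<lambda>i. x i * \<eta> (2 * i + e))" for r
  define n where "n r = tree_mean r (\<lambda>i. \<eta> (2 * i + e))" for r
  have 1: "tree_mean r (\<lambda>i. x (2 * i + e)) = \<alpha> * tree_mean r x + \<beta> + n r" for r
  proof -
    have "tree_mean r (\<lambda>i. x (2 * i + e)) = tree_mean r (\<lambda>i. \<alpha> * x i + \<beta> + \<eta> (2 * i + e))"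
      by (rule tree_mean_cong) (use rec in simp)
    then show ?thesis by (simp add: tree_mean_linear n_def)
  qed
  have 2: "tree_mean r (\<lambda>i. x i * x (2 * i + e))
      = \<alpha> * tree_mean r (\<lambda>i. (x i)\<^sup>2) + \<beta> * tree_mean r x + c r" for r
  proof -
    have "tree_mean r (\<lambda>i. x i * x (2 * i + e))
        = tree_mean r (\<lambda>i. \<alpha> * (x i)\<^sup>2 + \<beta> * x i + x i * \<eta> (2 * i + e))"
      by (rule tree_mean_cong) (use rec in \<open>simp add: power2_eq_square algebra_simps\<close>)
    then show ?thesis by (simp add: tree_mean_linear c_def)
  qed
  have "(\<lambda>r. \<alpha> + (c r - tree_mean r x * n r) / estim_denom r x) \<longlonglongrightarrow> \<alpha> + (0 - \<mu> * 0) / (q - \<mu>\<^sup>2)"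
    unfolding c_def n_def using limit_variance_pos
    by (intro tendsto_intros cross noise e tree_mean_tendsto estim_denom_tendsto) auto
  \<comment> \<open>The identity is only eventual, since it divides by a denominator that vanishes
    at \<open>r = 0\<close>.\<close>
  moreover have "\<forall>\<^sub>F r in sequentially.
      \<alpha> + (c r - tree_mean r x * n r) / estim_denom r x = alpha_hat e r x"
    using estim_denom_nonzero
  proof eventually_elim
    case (elim r)
    have "tree_mean r (\<lambda>i. x i * x (2 * i + e)) - tree_mean r x * tree_mean r (\<lambda>i. x (2 * i + e))
       = \<alpha> * estim_denom r x + (c r - tree_mean r x * n r)"
      unfolding 1 2 estim_denom_def by (simp add: power2_eq_square algebra_simps)
    then show ?case using elim by (simp add: alpha_hat_def add_divide_distrib)
  qed
  ultimately show \<alpha>_lim: "(\<lambda>r. alpha_hat e r x) \<longlonglongrightarrow> \<alpha>"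
    by (simp add: tendsto_cong)
  have "(\<lambda>r. \<alpha> * tree_mean r x + \<beta> + n r - alpha_hat e r x * tree_mean r x) \<longlonglongrightarrow> \<alpha> * \<mu> + \<beta> + 0 - \<alpha> * \<mu>"
    unfolding n_def by (intro tendsto_intros noise e tree_mean_tendsto \<alpha>_lim)
  then show "(\<lambda>r. beta_hat e r x) \<longlonglongrightarrow> \<beta>"
    by (simp add: beta_hat_def[abs_def] 1)
qed

text \<open>The default values may vary with \<open>r\<close>: along the path they are taken for
  finitely many \<open>r\<close> only.\<close>

lemma theta_hat_tendsto: "(\<lambda>r. theta_hat (d r) r x) \<longlonglongrightarrow> (\<alpha>0, \<beta>0, \<alpha>1, \<beta>1)"
proof -
  have "(\<lambda>r. (alpha_hat 0 r x, beta_hat 0 r x, alpha_hat 1 r x, beta_hat 1 r x))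
      \<longlonglongrightarrow> (\<alpha>0, \<beta>0, \<alpha>1, \<beta>1)"
    using even odd by (intro tendsto_Pair estimators_tendsto) auto
  moreover have "\<forall>\<^sub>F r in sequentially.
      (alpha_hat 0 r x, beta_hat 0 r x, alpha_hat 1 r x, beta_hat 1 r x) = theta_hat (d r) r x"
    using estim_denom_nonzero by eventually_elim (simp add: theta_hat_def)
  ultimately show ?thesis by (rule Lim_transform_eventually)
qed

end

section \<open>A strong law for orthogonal variables\<close>

text \<open>Exchanging sum and integral shows that the random series has finite expectation. It
  therefore converges almost surely, and its terms tend to 0.\<close>

lemma AE_tendsto_0_of_summable_integral:
  fixes f :: "nat \<Rightarrow> 'a \<Rightarrow> real"
  assumes f: "\<And>n. integrable M (f n)" and nonneg: "\<And>n \<omega>. 0 \<le> f n \<omega>"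
    and le: "\<And>n. (\<integral>\<omega>. f n \<omega> \<partial>M) \<le> c n" and c: "summable c"
  shows "AE \<omega> in M. (\<lambda>n. f n \<omega>) \<longlonglongrightarrow> 0"
proof -
  note f[THEN borel_measurable_integrable, measurable]
  have "summable (\<lambda>n. \<integral>\<omega>. f n \<omega> \<partial>M)"
    using le nonneg by (intro summable_comparison_test'[OF c, of 0]) (simp add: Bochner_Integration.integral_nonneg)
  then have "(\<Sum>n. ennreal (\<integral>\<omega>. f n \<omega> \<partial>M)) \<noteq> top"
    by (rule ennreal_suminf_neq_top) (simp add: nonneg Bochner_Integration.integral_nonneg)
  also have "(\<Sum>n. ennreal (\<integral>\<omega>. f n \<omega> \<partial>M)) = (\<Sum>n. \<integral>\<^sup>+\<omega>. f n \<omega> \<partial>M)"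
    by (intro suminf_cong nn_integral_eq_integral[symmetric] f) (simp add: nonneg)
  also have "\<dots> = (\<integral>\<^sup>+\<omega>. (\<Sum>n. ennreal (f n \<omega>)) \<partial>M)"
    by (rule nn_integral_suminf[symmetric]) simp
  finally have "AE \<omega> in M. (\<Sum>n. ennreal (f n \<omega>)) \<noteq> \<infinity>"
    by (intro nn_integral_PInf_AE) auto
  then show ?thesis
  proof eventually_elim
    case (elim \<omega>)
    then have "summable (\<lambda>n. f n \<omega>)"
      by (intro summable_suminf_not_top) (auto simp: nonneg)
    then show ?case by (rule summable_LIMSEQ_zero)
  qed
qed

lemma integrable_mult_of_squares:
  fixes f g :: "'a \<Rightarrow> real"
  assumes [measurable]: "f \<in> borel_measurable M" "g \<in> borel_measurable M"
    and f: "integrable M (\<lambda>\<omega>. (f \<omega>)\<^sup>2)" and g: "integrable M (\<lambda>\<omega>. (g \<omega>)\<^sup>2)"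
  shows "integrable M (\<lambda>\<omega>. f \<omega> * g \<omega>)"
proof (rule Bochner_Integration.integrable_bound[OF Bochner_Integration.integrable_add[OF f g]])
  have "\<bar>a * b\<bar> \<le> \<bar>a\<^sup>2 + b\<^sup>2\<bar>" for a b :: real
  proof -
    have "2 * \<bar>a * b\<bar> \<le> a\<^sup>2 + b\<^sup>2"
      using sum_squares_bound[of "\<bar>a\<bar>" "\<bar>b\<bar>"] by (simp add: abs_mult mult.assoc)
    then show ?thesis by linarith
  qed
  then show "AE \<omega> in M. norm (f \<omega> * g \<omega>) \<le> norm ((f \<omega>)\<^sup>2 + (g \<omega>)\<^sup>2)"
    by simp
qed simp

text \<open>Orthogonality leaves only the diagonal of the double sum, so the second moment of the
  mean is at most \<open>C\<close> divided by the tree size, which is summable in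
  \<open>r\<close>.\<close>

lemma tree_mean_orthogonal_tendsto_0:
  fixes Y :: "nat \<Rightarrow> 'a \<Rightarrow> real"
  assumes Y [measurable]: "\<And>i. i \<ge> 1 \<Longrightarrow> Y i \<in> borel_measurable M"
    and sq: "\<And>i. i \<ge> 1 \<Longrightarrow> integrable M (\<lambda>\<omega>. (Y i \<omega>)\<^sup>2)"
    and bound: "\<And>i. i \<ge> 1 \<Longrightarrow> (\<integral>\<omega>. (Y i \<omega>)\<^sup>2 \<partial>M) \<le> C"
    and orth: "\<And>i j. 1 \<le> i \<Longrightarrow> i < j \<Longrightarrow> (\<integral>\<omega>. Y i \<omega> * Y j \<omega> \<partial>M) = 0"
  shows "AE \<omega> in M. (\<lambda>r. tree_mean r (\<lambda>i. Y i \<omega>)) \<longlonglongrightarrow> 0"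
proof -
  have T: "i \<ge> 1" if "i \<in> tree_upto r" for i r
    using that by (simp add: tree_upto_def)
  have C: "C \<ge> 0"
    by (rule order_trans[OF Bochner_Integration.integral_nonneg bound[of 1]]) auto
  have prod: "integrable M (\<lambda>\<omega>. Y i \<omega> * Y j \<omega>)" if "i \<ge> 1" "j \<ge> 1" for i j
    using that by (intro integrable_mult_of_squares sq Y)
  have eq: "(tree_mean r (\<lambda>i. Y i \<omega>))\<^sup>2
      = (\<Sum>i\<in>tree_upto r. \<Sum>j\<in>tree_upto r. Y i \<omega> * Y j \<omega>) / (real (card (tree_upto r)))\<^sup>2" for r \<omega>
    by (simp add: tree_mean_def power_divide power2_eq_square sum_product)
  have int: "integrable M (\<lambda>\<omega>. (tree_mean r (\<lambda>i. Y i \<omega>))\<^sup>2)" for r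
    unfolding eq
    by (intro integrable_divide Bochner_Integration.integrable_sum prod T)
  have le: "(\<integral>\<omega>. (tree_mean r (\<lambda>i. Y i \<omega>))\<^sup>2 \<partial>M) \<le> C * (1 / 2) ^ r" for r
  proof -
    define N where "N = real (card (tree_upto r))"
    have N: "N > 0"
      using card_tree_upto_pos by (simp add: N_def)
    have "(\<integral>\<omega>. (\<Sum>i\<in>tree_upto r. \<Sum>j\<in>tree_upto r. Y i \<omega> * Y j \<omega>) \<partial>M)
        = (\<Sum>i\<in>tree_upto r. \<integral>\<omega>. (\<Sum>j\<in>tree_upto r. Y i \<omega> * Y j \<omega>) \<partial>M)"
      by (intro Bochner_Integration.integral_sum Bochner_Integration.integrable_sum prod T)
    also have "\<dots> = (\<Sum>i\<in>tree_upto r. \<Sum>j\<in>tree_upto r. \<integral>\<omega>. Y i \<omega> * Y j \<omega> \<partial>M)"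
      by (intro sum.cong refl Bochner_Integration.integral_sum prod T)
    also have "\<dots> = (\<Sum>i\<in>tree_upto r. \<Sum>j\<in>tree_upto r. if i = j then (\<integral>\<omega>. (Y i \<omega>)\<^sup>2 \<partial>M) else 0)"
    proof (intro sum.cong refl)
      fix i j assume "i \<in> tree_upto r" "j \<in> tree_upto r"
      with orth[of i j] orth[of j i] T[of i r] T[of j r]
      show "(\<integral>\<omega>. Y i \<omega> * Y j \<omega> \<partial>M) = (if i = j then (\<integral>\<omega>. (Y i \<omega>)\<^sup>2 \<partial>M) else 0)"
        by (cases i j rule: linorder_cases) (auto simp: power2_eq_square mult.commute)
    qed
    also have "\<dots> = (\<Sum>i\<in>tree_upto r. \<integral>\<omega>. (Y i \<omega>)\<^sup>2 \<partial>M)"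
      by (simp add: sum.delta)
    also have "\<dots> \<le> (\<Sum>i\<in>tree_upto r. C)"
      by (intro sum_mono bound T)
    also have "\<dots> = N * C"
      by (simp add: N_def)
    finally have "(\<integral>\<omega>. (tree_mean r (\<lambda>i. Y i \<omega>))\<^sup>2 \<partial>M) \<le> N * C / N\<^sup>2"
      unfolding eq N_def[symmetric] by (simp add: divide_right_mono)
    also have "\<dots> = C * (1 / N)"
      using N by (simp add: power2_eq_square)
    also have "\<dots> \<le> C * (1 / 2) ^ r"
      using C inverse_card_tree_upto_le[of r] by (intro mult_left_mono) (auto simp: N_def)
    finally show ?thesis .
  qed
  have "AE \<omega> in M. (\<lambda>r. (tree_mean r (\<lambda>i. Y i \<omega>))\<^sup>2) \<longlonglongrightarrow> 0"
    by (rule AE_tendsto_0_of_summable_integral[OF int _ le]) (auto intro!: summable_mult summable_geometric)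
  then show ?thesis
    by eventually_elim (simp add: power_tendsto_0_iff)
qed

lemma (in prob_space) integrable_of_square:
  fixes f :: "'a \<Rightarrow> real"
  assumes "f \<in> borel_measurable M" "integrable M (\<lambda>\<omega>. (f \<omega>)\<^sup>2)"
  shows "integrable M f"
  using integrable_mult_of_squares[of f M "\<lambda>_. 1"] assms by simp

section \<open>Independence and moments in the BAR model\<close>

text \<open>Only \<open>\<sigma>\<^sup>2 > 0\<close> is assumed, so \<open>\<sigma>\<close> may be
  negative; facts about positive standard deviations are applied to
  \<open>\<bar>\<sigma>\<bar>\<close>.\<close>

lemma normal_density_abs: "normal_density m \<bar>s\<bar> = normal_density m s"
  by (simp add: normal_density_def fun_eq_iff)

context bar_model
begin

section \<open>Independent innovations driving the model\<close>

lemma noise_pair_rv: "n \<ge> 1 \<Longrightarrow> random_variable borel (\<lambda>\<omega>. (\<epsilon> (2 * n) \<omega>, \<epsilon> (2 * n + 1) \<omega>))"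
  using noise_indep by (simp add: indep_vars_def2)

text \<open>The ancestor takes the slot \<open>0\<close> of the noise sequence, so that a single independent family
  drives the model.\<close>

definition innovation :: "nat \<Rightarrow> 'a \<Rightarrow> real \<times> real" where
  "innovation n \<omega> = (if n = 0 then (X 1 \<omega>, 0) else (\<epsilon> (2 * n) \<omega>, \<epsilon> (2 * n + 1) \<omega>))"

lemma innovation_rv [measurable]: "random_variable borel (innovation n)"
proof (cases "n = 0")
  case True
  then show ?thesis
    using X_rv[of 1] by (simp add: innovation_def[abs_def] borel_measurable_Pair)
next
  case False
  then show ?thesis
    using noise_pair_rv[of n] by (simp add: innovation_def[abs_def])
qed

text \<open>A finite intersection of events splits into an event of the ancestor and an event of the
  noise sequence. Independence of \<open>X 1\<close> from the noise separates the two, and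
  independence within the noise factors the second.\<close>

lemma indep_innovation: "indep_vars (\<lambda>_. borel) innovation UNIV"
  unfolding indep_vars_def2 indep_sets_def
proof (intro conjI ballI allI impI)
  fix J A assume J: "J \<noteq> {}" "finite J"
    and "A \<in> (\<Pi> j\<in>J. {innovation j -` B \<inter> space M |B. B \<in> sets borel})"
  then have "\<forall>j\<in>J. \<exists>B. A j = innovation j -` B \<inter> space M \<and> B \<in> sets borel"
    by (auto simp: Pi_iff)
  then obtain B where B: "\<And>j. j \<in> J \<Longrightarrow> A j = innovation j -` B j \<inter> space M"
      "\<And>j. j \<in> J \<Longrightarrow> B j \<in> sets borel"
    by metis
  have noise_prod: "prob (\<Inter>j\<in>K. A j) = (\<Prod>j\<in>K. prob (A j))" if K: "K \<subseteq> J" "K \<noteq> {}" "0 \<notin> K" for K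
  proof -
    have A: "A j = (\<lambda>\<omega>. (\<epsilon> (2 * j) \<omega>, \<epsilon> (2 * j + 1) \<omega>)) -` B j \<inter> space M" if "j \<in> K" for j
    proof -
      have "j \<in> J" using that K(1) by blast
      moreover have "j \<noteq> 0" using that K(3) by metis
      ultimately show ?thesis by (simp add: B innovation_def[abs_def])
    qed
    have "K \<subseteq> {1..}"
      using K by (metis Suc_leI atLeast_iff gr0I One_nat_def subsetI)
    then show ?thesis
      using indep_varsD[OF noise_indep, of K B] K J B(2) finite_subset[of K J]
      by (auto simp: A cong: INF_cong prod.cong)
  qed
  show "prob (\<Inter>j\<in>J. A j) = (\<Prod>j\<in>J. prob (A j))"
  \<comment> \<open>Only index sets mixing the ancestor with noise pairs call for
    \<open>noise_indep_X_1\<close>.\<close>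
  proof (cases "0 \<in> J \<and> J - {0} \<noteq> {}")
    case False
    then show ?thesis
    proof (cases "0 \<in> J")
      case True
      with False J have "J = {0}" by auto
      then show ?thesis by simp
    qed (use noise_prod[of J] J in auto)
  next
    case True
    define K where "K = J - {0}"
    have K: "K \<subseteq> J" "K \<noteq> {}" "0 \<notin> K" "finite K" and J_eq: "J = insert 0 K"
      using True J by (auto simp: K_def)
    have K1: "K \<subseteq> {1..}"
      using K by (metis Suc_leI atLeast_iff gr0I One_nat_def subsetI)
    let ?Z = "\<lambda>\<omega>. \<lambda>n\<in>{1::nat..}. (\<epsilon> (2 * n) \<omega>, \<epsilon> (2 * n + 1) \<omega>)"
    let ?E = "prod_emb {1..} (\<lambda>_. borel) K (Pi\<^sub>E K B)"
    \<comment> \<open>The second coordinate in slot 0 is constantly 0, so the event there is read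
      off from the slice of \<open>B 0\<close> at height 0.\<close>
    have "(\<lambda>x. (x, 0)) -` B 0 \<inter> space borel \<in> sets (borel :: real measure)"
      using B(2)[of 0] True
      by (intro measurable_sets[of _ _ borel]) (auto simp: borel_prod[symmetric])
    moreover have "A 0 = X 1 -` ((\<lambda>x. (x, 0)) -` B 0 \<inter> space borel) \<inter> space M"
      using B(1)[of 0] True by (simp add: innovation_def vimage_def)
    ultimately have A0: "A 0 \<in> {X 1 -` C \<inter> space M |C. C \<in> sets borel}"
      by blast
    \<comment> \<open>The intersection over \<open>K\<close> is the preimage, under the whole noise
      sequence, of the cylinder with base \<open>Pi\<^sub>E K B\<close>.\<close>
    have AK: "(\<Inter>j\<in>K. A j) \<in> {?Z -` C \<inter> space M |C. C \<in> sets (Pi\<^sub>M {1..} (\<lambda>_. borel))}"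
    proof (intro CollectI exI conjI)
      show "?E \<in> sets (Pi\<^sub>M {1..} (\<lambda>_. borel))"
        using K K1 B(2) by (intro sets_PiM_I) auto
      have 1: "\<omega> \<in> (\<Inter>j\<in>K. A j) \<longleftrightarrow> \<omega> \<in> space M \<and> (\<forall>j\<in>K. innovation j \<omega> \<in> B j)" for \<omega>
        using K B(1) by blast
      have 2: "\<omega> \<in> ?Z -` ?E \<inter> space M \<longleftrightarrow> \<omega> \<in> space M \<and> (\<forall>j\<in>K. innovation j \<omega> \<in> B j)" for \<omega>
      proof -
        have "innovation j \<omega> = ?Z \<omega> j" if "j \<in> K" for j
          using that K K1 by (auto simp: innovation_def)
        then show ?thesis
          using K1 by (auto simp: prod_emb_def space_PiM PiE_iff restrict_def extensional_def)
      qed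
      show "(\<Inter>j\<in>K. A j) = ?Z -` ?E \<inter> space M"
        by (rule set_eqI) (rule trans[OF 1 2[symmetric]])
    qed
    have "prob (A 0 \<inter> (\<Inter>j\<in>K. A j)) = prob (A 0) * prob (\<Inter>j\<in>K. A j)"
      using noise_indep_X_1 unfolding indep_rv_def by (blast intro: indep_setD[OF _ A0 AK])
    then show ?thesis
      using noise_prod[of K] K by (simp add: J_eq)
  qed
qed auto

text \<open>The innovation of index \<open>n\<close> is the noise of the daughters of \<open>n\<close>, so \<open>X n\<close> is determined by the
  innovations of index strictly below \<open>n\<close>.\<close>

definition determined_by :: "nat \<Rightarrow> ('a \<Rightarrow> real) \<Rightarrow> bool" where
  "determined_by n Y \<longleftrightarrow> (\<exists>H\<in>borel_measurable (Pi\<^sub>M {..<n} (\<lambda>_. borel)).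
     AE \<omega> in M. Y \<omega> = H (\<lambda>i\<in>{..<n}. innovation i \<omega>))"

lemma determined_by_mono:
  assumes "determined_by m Y" "m \<le> n"
  shows "determined_by n Y"
proof -
  obtain H where H: "H \<in> borel_measurable (Pi\<^sub>M {..<m} (\<lambda>_. borel))"
      "AE \<omega> in M. Y \<omega> = H (\<lambda>i\<in>{..<m}. innovation i \<omega>)"
    using assms(1) by (auto simp: determined_by_def)
  have "(\<lambda>z. H (restrict z {..<m})) \<in> borel_measurable (Pi\<^sub>M {..<n} (\<lambda>_. borel))"
    using assms(2) by (intro measurable_compose[OF measurable_restrict_subset H(1)]) auto
  moreover have "restrict (\<lambda>i\<in>{..<n}. innovation i \<omega>) {..<m} = (\<lambda>i\<in>{..<m}. innovation i \<omega>)" for \<omega>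
    using assms(2) by (auto simp: restrict_def fun_eq_iff)
  ultimately show ?thesis
    using H(2) unfolding determined_by_def by (intro bexI[of _ "\<lambda>z. H (restrict z {..<m})"]) auto
qed

lemma determined_by_compose2:
  assumes "determined_by n Y" "determined_by n Z"
    and [measurable]: "case_prod g \<in> borel_measurable (borel \<Otimes>\<^sub>M borel)"
  shows "determined_by n (\<lambda>\<omega>. g (Y \<omega>) (Z \<omega>))"
proof -
  obtain H where H [measurable]: "H \<in> borel_measurable (Pi\<^sub>M {..<n} (\<lambda>_. borel))"
      and HY: "AE \<omega> in M. Y \<omega> = H (\<lambda>i\<in>{..<n}. innovation i \<omega>)"
    using assms(1) by (auto simp: determined_by_def)
  obtain G where G [measurable]: "G \<in> borel_measurable (Pi\<^sub>M {..<n} (\<lambda>_. borel))"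
      and GZ: "AE \<omega> in M. Z \<omega> = G (\<lambda>i\<in>{..<n}. innovation i \<omega>)"
    using assms(2) by (auto simp: determined_by_def)
  show ?thesis
    unfolding determined_by_def
  proof (rule bexI)
    show "AE \<omega> in M. g (Y \<omega>) (Z \<omega>)
        = (\<lambda>z. g (H z) (G z)) (\<lambda>i\<in>{..<n}. innovation i \<omega>)"
      using HY GZ by eventually_elim simp
  qed simp
qed

lemma determined_by_innovation:
  assumes "i < n" and [measurable]: "g \<in> borel_measurable borel"
  shows "determined_by n (\<lambda>\<omega>. g (innovation i \<omega>))"
  unfolding determined_by_def
  using assms(1) by (intro bexI[of _ "\<lambda>z. g (z i)"]) auto

lemma determined_by_const: "determined_by n (\<lambda>_. c)"
  unfolding determined_by_def by (intro bexI[of _ "\<lambda>_. c"]) auto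

text \<open>Needed because the recursion is only an almost sure identity.\<close>

lemma determined_by_AE_cong:
  assumes "determined_by n Y" "AE \<omega> in M. Z \<omega> = Y \<omega>"
  shows "determined_by n Z"
proof -
  obtain H where H: "H \<in> borel_measurable (Pi\<^sub>M {..<n} (\<lambda>_. borel))"
      "AE \<omega> in M. Y \<omega> = H (\<lambda>i\<in>{..<n}. innovation i \<omega>)"
    using assms(1) by (auto simp: determined_by_def)
  then show ?thesis
    using assms(2) unfolding determined_by_def by (intro bexI[OF _ H(1)]) auto
qed

section \<open>Recursion along the tree and dependence on the past\<close>

definition noise_coord :: "nat \<Rightarrow> real \<times> real \<Rightarrow> real" where
  "noise_coord e = (if e = 0 then fst else snd)"

lemma noise_coord_measurable [measurable]: "noise_coord e \<in> borel_measurable borel"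
  unfolding noise_coord_def by (auto intro!: borel_measurable_continuous_onI continuous_intros)

lemma noise_eq: "n \<ge> 1 \<Longrightarrow> e \<in> {0, 1} \<Longrightarrow> \<epsilon> (2 * n + e) = (\<lambda>\<omega>. noise_coord e (innovation n \<omega>))"
  by (auto simp: noise_coord_def innovation_def fun_eq_iff)

definition slope :: "nat \<Rightarrow> real" where "slope e = (if e = 0 then \<alpha>0 else \<alpha>1)"
definition intercept :: "nat \<Rightarrow> real" where "intercept e = (if e = 0 then \<beta>0 else \<beta>1)"

lemma X_daughter:
  assumes "n \<ge> 1" "e \<in> {0, 1}"
  shows "AE \<omega> in M. X (2 * n + e) \<omega> = slope e * X n \<omega> + intercept e + \<epsilon> (2 * n + e) \<omega>"
  using assms X_even[of n] X_odd[of n] by (auto simp: slope_def intercept_def)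

lemma abs_slope: "\<bar>slope e\<bar> < 1"
  using alpha0 alpha1 by (simp add: slope_def abs_less_iff)

text \<open>A vertex \<open>n > 1\<close> is the daughter of type \<open>n mod 2\<close> of the
  smaller vertex \<open>n div 2\<close>.\<close>

lemma tree_induct [consumes 1, case_names root daughter]:
  fixes n :: nat
  assumes "n \<ge> 1" and "P 1" and "\<And>m e. m \<ge> 1 \<Longrightarrow> e \<in> {0, 1} \<Longrightarrow> P m \<Longrightarrow> P (2 * m + e)"
  shows "P n"
  using assms(1)
proof (induction n rule: less_induct)
  case (less n)
  show ?case
  proof (cases "n = 1")
    case False
    with less.prems have n: "n div 2 \<ge> 1" "n div 2 < n" by auto
    have "P (2 * (n div 2) + n mod 2)"
      using n by (intro assms(3) less.IH) auto
    then show ?thesis by simp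
  qed (use assms(2) in simp)
qed

text \<open>\<open>X 1\<close> is read off innovation 0, and a daughter of \<open>m\<close> from
  \<open>X m\<close> and innovation \<open>m\<close>. Both lie in its past, since
  \<open>m < 2 * m + e\<close> for \<open>m \<ge> 1\<close>.\<close>

lemma determined_by_X: "n \<ge> 1 \<Longrightarrow> determined_by n (X n)"
proof (induction n rule: tree_induct)
  case root
  have "determined_by 1 (\<lambda>\<omega>. noise_coord 0 (innovation 0 \<omega>))"
    by (rule determined_by_innovation) auto
  then show ?case
    by (rule determined_by_AE_cong) (simp add: innovation_def noise_coord_def)
next
  case (daughter m e)
  show ?case
  proof (rule determined_by_AE_cong[OF determined_by_compose2[where Y = "X m"
          and Z = "\<lambda>\<omega>. noise_coord e (innovation m \<omega>)" and g = "\<lambda>x y. slope e * x + intercept e + y"]])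
    show "AE \<omega> in M. X (2 * m + e) \<omega>
        = slope e * X m \<omega> + intercept e + noise_coord e (innovation m \<omega>)"
      using X_daughter[of m e] daughter by (simp add: noise_eq)
    show "determined_by (2 * m + e) (X m)"
      using daughter by (intro determined_by_mono[OF daughter.IH]) auto
    show "determined_by (2 * m + e) (\<lambda>\<omega>. noise_coord e (innovation m \<omega>))"
      using daughter by (intro determined_by_innovation) auto
  qed measurable
qed

text \<open>This replaces conditioning on the past: up to a null set, \<open>Y\<close> is a function
  of innovations below \<open>n\<close>, hence independent of innovation \<open>n\<close>.\<close>

lemma determined_by_indep:
  assumes Y: "determined_by n Y" and [measurable]: "g \<in> borel_measurable borel"
    and intY: "integrable M Y" and intg: "integrable M (\<lambda>\<omega>. g (innovation n \<omega>))"
  shows "integrable M (\<lambda>\<omega>. Y \<omega> * g (innovation n \<omega>))"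
    and "expectation (\<lambda>\<omega>. Y \<omega> * g (innovation n \<omega>)) = expectation Y * expectation (\<lambda>\<omega>. g (innovation n \<omega>))"
proof -
  obtain H where H [measurable]: "H \<in> borel_measurable (Pi\<^sub>M {..<n} (\<lambda>_. borel))"
      and HY: "AE \<omega> in M. Y \<omega> = H (\<lambda>i\<in>{..<n}. innovation i \<omega>)"
    using Y by (auto simp: determined_by_def)
  let ?H = "\<lambda>\<omega>. H (\<lambda>i\<in>{..<n}. innovation i \<omega>)"
  have [measurable]: "Y \<in> borel_measurable M" using intY by simp
  have [measurable]: "?H \<in> borel_measurable M" by measurable
  \<comment> \<open>The index blocks \<open>{..<n}\<close> and \<open>{n}\<close> of the independent
    family are disjoint.\<close>
  have "indep_var borel (H \<circ> (\<lambda>\<omega>. restrict (\<lambda>i. innovation i \<omega>) {..<n}))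
      borel ((\<lambda>z. g (z n)) \<circ> (\<lambda>\<omega>. restrict (\<lambda>i. innovation i \<omega>) {n}))"
    by (intro indep_var_compose[OF indep_var_restrict[OF indep_innovation]]) auto
  then have ind: "indep_var borel ?H borel (\<lambda>\<omega>. g (innovation n \<omega>))"
    by (simp add: comp_def)
  have intH: "integrable M ?H"
    using intY HY by (subst integrable_cong_AE[of _ _ Y]) auto
  have prod: "AE \<omega> in M. Y \<omega> * g (innovation n \<omega>) = ?H \<omega> * g (innovation n \<omega>)"
    using HY by eventually_elim simp
  show "integrable M (\<lambda>\<omega>. Y \<omega> * g (innovation n \<omega>))"
    using indep_var_integrable[OF ind intH intg] prod
    by (subst integrable_cong_AE[OF _ _ prod]) auto
  have "expectation (\<lambda>\<omega>. Y \<omega> * g (innovation n \<omega>)) = expectation (\<lambda>\<omega>. ?H \<omega> * g (innovation n \<omega>))"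
    by (intro integral_cong_AE prod) auto
  also have "\<dots> = expectation ?H * expectation (\<lambda>\<omega>. g (innovation n \<omega>))"
    by (rule indep_var_lebesgue_integral[OF ind intH intg])
  also have "expectation ?H = expectation Y"
    using HY by (intro integral_cong_AE) auto
  finally show "expectation (\<lambda>\<omega>. Y \<omega> * g (innovation n \<omega>))
      = expectation Y * expectation (\<lambda>\<omega>. g (innovation n \<omega>))" .
qed

section \<open>Gaussian law and moments of a single noise variable\<close>

lemma sigma_abs: "\<bar>\<sigma>\<bar> > 0"
  using sigma by auto

text \<open>In the factorization into marginal and conditional density, the conditional normal
  density integrates to 1.\<close>

lemma bivariate_normal_marginal:
  "(\<integral>\<^sup>+y. ennreal (bivariate_normal_density \<sigma> \<rho> (x, y)) \<partial>lborel) = ennreal (normal_density 0 \<sigma> x)"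
proof -
  define \<tau> where "\<tau> = \<bar>\<sigma> * sqrt (1 - \<rho>\<^sup>2)\<bar>"
  have \<rho>: "\<bar>\<rho>\<bar> < 1" using rho by simp
  then have \<tau>: "\<tau> > 0"
    using sigma by (simp add: \<tau>_def abs_square_less_1 abs_square_eq_1)
  have "(\<integral>\<^sup>+y. ennreal (bivariate_normal_density \<sigma> \<rho> (x, y)) \<partial>lborel)
      = (\<integral>\<^sup>+y. ennreal (normal_density 0 \<sigma> x) * ennreal (normal_density (\<rho> * x) \<tau> y) \<partial>lborel)"
    unfolding bivariate_normal_density_eq[OF sigma \<rho>] \<tau>_def normal_density_abs
    by (simp add: ennreal_mult)
  also have "\<dots> = ennreal (normal_density 0 \<sigma> x) * (\<integral>\<^sup>+y. ennreal (normal_density (\<rho> * x) \<tau> y) \<partial>lborel)"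
    by (rule nn_integral_cmult) simp
  also have "(\<integral>\<^sup>+y. ennreal (normal_density (\<rho> * x) \<tau> y) \<partial>lborel) = 1"
    using \<tau> by (subst nn_integral_eq_integral) auto
  finally show ?thesis by simp
qed

lemma bivariate_normal_density_commute:
  "bivariate_normal_density \<sigma> \<rho> (x, y) = bivariate_normal_density \<sigma> \<rho> (y, x)"
  by (simp add: bivariate_normal_density_def algebra_simps)

text \<open>The noises of both types are marginals of the pair; symmetry of the density reduces the
  second marginal to the first.\<close>

lemma noise_normal:
  assumes "n \<ge> 1" "e \<in> {0, 1}"
  shows "distributed M lborel (\<epsilon> (2 * n + e)) (\<lambda>x. ennreal (normal_density 0 \<sigma> x))"
proof -
  have "distributed M (lborel \<Otimes>\<^sub>M lborel) (\<lambda>\<omega>. (\<epsilon> (2 * n) \<omega>, \<epsilon> (2 * n + 1) \<omega>))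
        (\<lambda>z. ennreal (bivariate_normal_density \<sigma> \<rho> z))"
    using noise_gaussian[OF assms(1)] by (simp add: lborel_prod)
  from distr_marginal1[OF _ _ this] distr_marginal2[OF _ _ this]
  have "distributed M lborel (\<epsilon> (2 * n)) (\<lambda>x. \<integral>\<^sup>+y. ennreal (bivariate_normal_density \<sigma> \<rho> (x, y)) \<partial>lborel)"
    "distributed M lborel (\<epsilon> (2 * n + 1)) (\<lambda>y. \<integral>\<^sup>+x. ennreal (bivariate_normal_density \<sigma> \<rho> (x, y)) \<partial>lborel)"
    by (simp_all add: lborel.sigma_finite_measure_axioms)
  then show ?thesis
    using assms(2) bivariate_normal_density_commute by (auto simp: bivariate_normal_marginal)
qed

lemma noise_expectation:
  assumes "n \<ge> 1" "e \<in> {0, 1}" "g \<in> borel_measurable borel"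
  shows "expectation (\<lambda>\<omega>. g (\<epsilon> (2 * n + e) \<omega>)) = (\<integral>x. normal_density 0 \<sigma> x * g x \<partial>lborel)"
  using assms(3) by (intro distributed_integral[OF noise_normal[OF assms(1,2)], symmetric]) auto

lemma noise_integrable:
  assumes "n \<ge> 1" "e \<in> {0, 1}" "g \<in> borel_measurable borel"
  shows "integrable M (\<lambda>\<omega>. g (\<epsilon> (2 * n + e) \<omega>)) \<longleftrightarrow> integrable lborel (\<lambda>x. normal_density 0 \<sigma> x * g x)"
  using assms(3) by (intro distributed_integrable[OF noise_normal[OF assms(1,2)], symmetric]) auto

lemma integrable_normal_power: "integrable lborel (\<lambda>x. normal_density 0 \<sigma> x * x ^ k)"
  using integrable_normal_moment[OF sigma_abs, of 0 k] by (simp add: normal_density_abs)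

lemma normal_mean: "(\<integral>x. normal_density 0 \<sigma> x * x \<partial>lborel) = 0"
  using integral_normal_moment_nz_1[OF sigma_abs, of 0] by (simp add: normal_density_abs)

lemma normal_second_moment: "(\<integral>x. normal_density 0 \<sigma> x * x\<^sup>2 \<partial>lborel) = \<sigma>\<^sup>2"
  using integral_normal_moment_even[OF sigma_abs, of 0 1]
  by (simp add: normal_density_abs power2_eq_square)

text \<open>The common source of all limits required by \<open>bar_path\<close>. For
  \<open>i < j\<close>, the product of term \<open>i\<close> with \<open>W j\<close> is determined
  by innovations below \<open>j\<close>, hence independent of the centered noise factor at
  \<open>j\<close>, which gives orthogonality. The same independence factors each second
  moment.\<close>

lemma weighted_noise_tree_mean_tendsto_0:
  fixes W :: "nat \<Rightarrow> 'a \<Rightarrow> real"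
  assumes e: "e \<in> {0, 1}" and g [measurable]: "g \<in> borel_measurable borel"
    and g0: "(\<integral>x. normal_density 0 \<sigma> x * g x \<partial>lborel) = 0"
    and g2: "integrable lborel (\<lambda>x. normal_density 0 \<sigma> x * (g x)\<^sup>2)"
    and W: "\<And>i. i \<ge> 1 \<Longrightarrow> determined_by i (W i)"
    and Wm [measurable]: "\<And>i. i \<ge> 1 \<Longrightarrow> random_variable borel (W i)"
    and W2: "\<And>i. i \<ge> 1 \<Longrightarrow> integrable M (\<lambda>\<omega>. (W i \<omega>)\<^sup>2)"
    and WC: "\<And>i. i \<ge> 1 \<Longrightarrow> expectation (\<lambda>\<omega>. (W i \<omega>)\<^sup>2) \<le> C"
  shows "AE \<omega> in M. (\<lambda>r. tree_mean r (\<lambda>i. W i \<omega> * g (\<epsilon> (2 * i + e) \<omega>))) \<longlonglongrightarrow> 0"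
proof -
  define G where "G i \<omega> = g (noise_coord e (innovation i \<omega>))" for i \<omega>
  have G: "g (\<epsilon> (2 * i + e) \<omega>) = G i \<omega>" if "i \<ge> 1" for i \<omega>
    using that e by (simp add: noise_eq G_def)
  have Gm [measurable]: "random_variable borel (G i)" for i
    unfolding G_def[abs_def] by measurable
  have G2: "integrable M (\<lambda>\<omega>. (G i \<omega>)\<^sup>2)" if "i \<ge> 1" for i
    using noise_integrable[OF that e, of "\<lambda>x. (g x)\<^sup>2"] g2 by (simp add: G[OF that])
  have EG: "expectation (G i) = 0" if "i \<ge> 1" for i
    using noise_expectation[OF that e g] g0 by (simp add: G[OF that])
  define K where "K = (\<integral>x. normal_density 0 \<sigma> x * (g x)\<^sup>2 \<partial>lborel)"
  have EG2: "expectation (\<lambda>\<omega>. (G i \<omega>)\<^sup>2) = K" if "i \<ge> 1" for i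
    using noise_expectation[OF that e, of "\<lambda>x. (g x)\<^sup>2"] by (simp add: G[OF that] K_def)
  have "K \<ge> 0" by (simp add: K_def Bochner_Integration.integral_nonneg)
  have det: "determined_by j (\<lambda>\<omega>. W i \<omega> * G i \<omega> * W j \<omega>)" if "1 \<le> i" "i < j" for i j
  proof -
    have "determined_by j (G i)"
      using that unfolding G_def[abs_def] by (intro determined_by_innovation) auto
    moreover have "determined_by j (W i)" "determined_by j (W j)"
      using that by (auto intro: determined_by_mono[OF W])
    ultimately show ?thesis
      by (intro determined_by_compose2[where g = "(*)"]) auto
  qed
  have sq: "integrable M (\<lambda>\<omega>. (W i \<omega> * G i \<omega>)\<^sup>2)"
    "expectation (\<lambda>\<omega>. (W i \<omega> * G i \<omega>)\<^sup>2) = expectation (\<lambda>\<omega>. (W i \<omega>)\<^sup>2) * K" if "i \<ge> 1" for i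
  proof -
    have "determined_by i (\<lambda>\<omega>. (W i \<omega>)\<^sup>2)"
      unfolding power2_eq_square using that
      by (intro determined_by_compose2[where g = "(*)"] W) auto
    from determined_by_indep[OF this, of "\<lambda>z. (g (noise_coord e z))\<^sup>2"]
    show "integrable M (\<lambda>\<omega>. (W i \<omega> * G i \<omega>)\<^sup>2)"
      "expectation (\<lambda>\<omega>. (W i \<omega> * G i \<omega>)\<^sup>2) = expectation (\<lambda>\<omega>. (W i \<omega>)\<^sup>2) * K"
      using that W2 G2 EG2 by (simp_all add: power_mult_distrib G_def)
  qed
  have "AE \<omega> in M. (\<lambda>r. tree_mean r (\<lambda>i. W i \<omega> * G i \<omega>)) \<longlonglongrightarrow> 0"
  proof (rule tree_mean_orthogonal_tendsto_0)
    fix i :: nat assume i: "i \<ge> 1"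
    show "random_variable borel (\<lambda>\<omega>. W i \<omega> * G i \<omega>)" using i by measurable
    show "integrable M (\<lambda>\<omega>. (W i \<omega> * G i \<omega>)\<^sup>2)" by (rule sq[OF i])
    show "expectation (\<lambda>\<omega>. (W i \<omega> * G i \<omega>)\<^sup>2) \<le> C * K"
      using \<open>K \<ge> 0\<close> WC[OF i] by (simp add: sq[OF i] mult_right_mono)
    fix j assume j: "i < j"
    \<comment> \<open>The triple product is grouped as \<open>W i * G i\<close> times
      \<open>W j\<close>, two square-integrable factors.\<close>
    have "integrable M (\<lambda>\<omega>. W i \<omega> * G i \<omega> * W j \<omega>)"
      using i j by (intro integrable_mult_of_squares sq W2) auto
    moreover have "integrable M (G j)"
      using i j by (intro integrable_of_square[OF Gm G2]) simp
    ultimately have "expectation (\<lambda>\<omega>. W i \<omega> * G i \<omega> * W j \<omega> * G j \<omega>) = 0"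
      using determined_by_indep(2)[OF det[OF i j], of "\<lambda>z. g (noise_coord e z)"] EG[of j] i j
      by (simp add: G_def[abs_def])
    then show "expectation (\<lambda>\<omega>. W i \<omega> * G i \<omega> * (W j \<omega> * G j \<omega>)) = 0"
      by (simp add: mult.assoc)
  qed
  moreover have "tree_mean r (\<lambda>i. W i \<omega> * g (\<epsilon> (2 * i + e) \<omega>)) = tree_mean r (\<lambda>i. W i \<omega> * G i \<omega>)" for r \<omega>
    by (rule tree_mean_cong) (simp only: G)
  ultimately show ?thesis
    by simp
qed

text \<open>Up to the sign of \<open>x\<close>, \<open>a * x + b\<close> is a convex combination of
  \<open>x\<close> and \<open>b / (1 - \<bar>a\<bar>)\<close> with weights
  \<open>\<bar>a\<bar>\<close> and \<open>1 - \<bar>a\<bar>\<close>. The factor of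
  \<open>x\<^sup>2\<close> stays below 1, which bounds second moments along the tree.\<close>

lemma convex_combination_square_bound:
  fixes a x b :: real
  assumes "\<bar>a\<bar> < 1"
  shows "(a * x + b)\<^sup>2 \<le> \<bar>a\<bar> * x\<^sup>2 + b\<^sup>2 / (1 - \<bar>a\<bar>)"
proof -
  define t where "t = 1 - \<bar>a\<bar>"
  have t: "t > 0" and a: "\<bar>a\<bar> = 1 - t" using assms by (auto simp: t_def)
  have "a * x * b \<le> \<bar>a\<bar> * \<bar>x * b\<bar>"
    by (metis abs_ge_self abs_mult mult.assoc)
  then have "2 * t * (a * x * b) \<le> 2 * t * (\<bar>a\<bar> * \<bar>x * b\<bar>)"
    using t by (intro mult_left_mono) auto
  also have "\<dots> = \<bar>a\<bar> * (2 * (t * \<bar>x\<bar>) * \<bar>b\<bar>)"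
    by (simp add: abs_mult)
  \<comment> \<open>Weighting \<open>x\<close> by \<open>t\<close> makes the coefficients add up:
    since \<open>\<bar>a\<bar> + t = 1\<close>, the sum of \<open>t * \<bar>a\<bar>\<^sup>2\<close>
    and \<open>\<bar>a\<bar> * t\<^sup>2\<close> is \<open>t * \<bar>a\<bar>\<close>.\<close>
  also have "\<dots> \<le> \<bar>a\<bar> * ((t * \<bar>x\<bar>)\<^sup>2 + \<bar>b\<bar>\<^sup>2)"
    by (intro mult_left_mono sum_squares_bound) auto
  finally have cross: "2 * t * (a * x * b) \<le> \<bar>a\<bar> * (t\<^sup>2 * x\<^sup>2 + b\<^sup>2)"
    by (simp add: power_mult_distrib)
  have "t * (a * x + b)\<^sup>2 = t * (\<bar>a\<bar>\<^sup>2 * x\<^sup>2 + b\<^sup>2) + 2 * t * (a * x * b)"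
    by (simp add: power2_eq_square algebra_simps)
  also have "\<dots> \<le> t * (\<bar>a\<bar>\<^sup>2 * x\<^sup>2 + b\<^sup>2) + \<bar>a\<bar> * (t\<^sup>2 * x\<^sup>2 + b\<^sup>2)"
    using cross by simp
  also have "\<dots> = t * (\<bar>a\<bar> * x\<^sup>2) + b\<^sup>2"
    unfolding a by (simp add: power2_eq_square algebra_simps)
  finally have "(a * x + b)\<^sup>2 \<le> (t * (\<bar>a\<bar> * x\<^sup>2) + b\<^sup>2) / t"
    using t by (simp add: pos_le_divide_eq mult.commute)
  then show ?thesis
    using t by (simp add: add_divide_distrib t_def)
qed

text \<open>Induction along the tree: for both types, the affine map bounding a daughter's second
  moment by its mother's sends every value up to \<open>C\<close> to a value up to
  \<open>C\<close>.\<close>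

lemma X_second_moment:
  assumes X1: "integrable M (\<lambda>\<omega>. (X 1 \<omega>)\<^sup>2)"
  shows "\<exists>C. \<forall>n\<ge>1. integrable M (\<lambda>\<omega>. (X n \<omega>)\<^sup>2) \<and> expectation (\<lambda>\<omega>. (X n \<omega>)\<^sup>2) \<le> C"
proof -
  \<comment> \<open>The expectation of the last term of the convexity bound when \<open>b\<close> is
    intercept plus noise.\<close>
  define K where "K e = (\<integral>x. normal_density 0 \<sigma> x * ((intercept e + x)\<^sup>2 / (1 - \<bar>slope e\<bar>)) \<partial>lborel)" for e
  \<comment> \<open>Each quotient is the fixed point of the bounding map of one type; the maximum
    dominates both and the ancestor's second moment.\<close>
  define C where "C = Max {expectation (\<lambda>\<omega>. (X 1 \<omega>)\<^sup>2), K 0 / (1 - \<bar>slope 0\<bar>), K 1 / (1 - \<bar>slope 1\<bar>)}"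
  have C: "\<bar>slope e\<bar> * C + K e \<le> C" if "e \<in> {0, 1}" for e
  proof -
    have "K e / (1 - \<bar>slope e\<bar>) \<le> C"
      using that by (auto simp: C_def)
    then show ?thesis
      using abs_slope[of e] by (simp add: pos_divide_le_eq algebra_simps)
  qed
  have "integrable M (\<lambda>\<omega>. (X n \<omega>)\<^sup>2) \<and> expectation (\<lambda>\<omega>. (X n \<omega>)\<^sup>2) \<le> C" if "n \<ge> 1" for n
    using that
  proof (induction n rule: tree_induct)
    case root
    then show ?case using X1 by (simp add: C_def)
  next
    case (daughter m e)
    define N where "N \<omega> = (intercept e + \<epsilon> (2 * m + e) \<omega>)\<^sup>2 / (1 - \<bar>slope e\<bar>)" for \<omega>
    have [measurable]: "random_variable borel (X (2 * m + e))" "random_variable borel (X m)"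
      using daughter by (auto intro: X_rv)
    have "integrable lborel (\<lambda>x. normal_density 0 \<sigma> x * ((intercept e + x)\<^sup>2 / (1 - \<bar>slope e\<bar>)))"
    proof -
      \<comment> \<open>Written in powers of \<open>x\<close>, including \<open>x ^ 0\<close>, to
        match \<open>integrable_normal_power\<close>.\<close>
      have "normal_density 0 \<sigma> x * ((intercept e + x)\<^sup>2 / (1 - \<bar>slope e\<bar>))
         = ((intercept e)\<^sup>2 * (normal_density 0 \<sigma> x * x ^ 0)
           + 2 * intercept e * (normal_density 0 \<sigma> x * x ^ 1)
           + normal_density 0 \<sigma> x * x ^ 2) / (1 - \<bar>slope e\<bar>)" for x
        by (simp add: power2_sum algebra_simps add_divide_distrib)
      then show ?thesis
        by (simp only:) (intro integrable_divide Bochner_Integration.integrable_add integrable_mult_right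
            integrable_normal_power)
    qed
    then have N: "integrable M N" "expectation N = K e"
      using noise_integrable[of m e "\<lambda>x. (intercept e + x)\<^sup>2 / (1 - \<bar>slope e\<bar>)"]
        noise_expectation[of m e "\<lambda>x. (intercept e + x)\<^sup>2 / (1 - \<bar>slope e\<bar>)"] daughter
      by (simp_all add: N_def[abs_def] K_def)
    have le: "AE \<omega> in M. (X (2 * m + e) \<omega>)\<^sup>2 \<le> \<bar>slope e\<bar> * (X m \<omega>)\<^sup>2 + N \<omega>"
      using X_daughter[OF daughter.hyps]
    proof eventually_elim
      case (elim \<omega>)
      then show ?case
        using convex_combination_square_bound[OF abs_slope, of e "X m \<omega>" "intercept e + \<epsilon> (2 * m + e) \<omega>"]
        by (simp add: N_def add.assoc)
    qed
    have maj: "integrable M (\<lambda>\<omega>. \<bar>slope e\<bar> * (X m \<omega>)\<^sup>2 + N \<omega>)"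
      using daughter N by simp
    have int: "integrable M (\<lambda>\<omega>. (X (2 * m + e) \<omega>)\<^sup>2)"
      by (rule Bochner_Integration.integrable_bound[OF maj]) (use le in auto)
    have "expectation (\<lambda>\<omega>. (X (2 * m + e) \<omega>)\<^sup>2) \<le> expectation (\<lambda>\<omega>. \<bar>slope e\<bar> * (X m \<omega>)\<^sup>2 + N \<omega>)"
      by (rule integral_mono_AE[OF int maj le])
    also have "\<dots> = \<bar>slope e\<bar> * expectation (\<lambda>\<omega>. (X m \<omega>)\<^sup>2) + K e"
      using daughter N by simp
    also have "\<dots> \<le> \<bar>slope e\<bar> * C + K e"
      using daughter by (intro add_right_mono mult_left_mono) auto
    also have "\<dots> \<le> C" using daughter by (intro C)
    finally show ?case using int by simp
  qed
  then show ?thesis by blast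
qed

text \<open>The recursion at all vertices and the six limits hold together outside a null set; each
  remaining outcome is an instance of \<open>bar_path\<close>.\<close>

lemma theta_hat_tendsto_AE:
  assumes X1: "integrable M (\<lambda>\<omega>. (X 1 \<omega>)\<^sup>2)"
  shows "AE \<omega> in M. (\<lambda>r. theta_hat (d r \<omega>) r (\<lambda>i. X i \<omega>)) \<longlonglongrightarrow> (\<alpha>0, \<beta>0, \<alpha>1, \<beta>1)"
proof -
  obtain C where C: "\<And>n. n \<ge> 1 \<Longrightarrow> integrable M (\<lambda>\<omega>. (X n \<omega>)\<^sup>2)"
      "\<And>n. n \<ge> 1 \<Longrightarrow> expectation (\<lambda>\<omega>. (X n \<omega>)\<^sup>2) \<le> C"
    using X_second_moment[OF X1] by blast
  have sq: "integrable lborel (\<lambda>x. normal_density 0 \<sigma> x * x\<^sup>2)"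
    by (rule integrable_normal_power)
  \<comment> \<open>The constant weight 1 is determined by any past and has second moment 1.\<close>
  have unweighted: "AE \<omega> in M. (\<lambda>r. tree_mean r (\<lambda>i. g (\<epsilon> (2 * i + e) \<omega>))) \<longlonglongrightarrow> 0"
    if "e \<in> {0, 1}" "g \<in> borel_measurable borel" "(\<integral>x. normal_density 0 \<sigma> x * g x \<partial>lborel) = 0"
      "integrable lborel (\<lambda>x. normal_density 0 \<sigma> x * (g x)\<^sup>2)" for e g
    using weighted_noise_tree_mean_tendsto_0[OF that, of "\<lambda>_ _. 1" 1]
    by (simp add: determined_by_const prob_space)
  have noise: "AE \<omega> in M. (\<lambda>r. tree_mean r (\<lambda>i. \<epsilon> (2 * i + e) \<omega>)) \<longlonglongrightarrow> 0" if "e \<in> {0, 1}" for e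
    using unweighted[OF that, of "\<lambda>x. x"] normal_mean sq by simp
  have noise_sq: "AE \<omega> in M. (\<lambda>r. tree_mean r (\<lambda>i. (\<epsilon> (2 * i + e) \<omega>)\<^sup>2)) \<longlonglongrightarrow> \<sigma>\<^sup>2"
    if e: "e \<in> {0, 1}" for e
  proof -
    \<comment> \<open>Square integrability of the centered squared noise reduces to Gaussian moments
      up to order four.\<close>
    have "normal_density 0 \<sigma> x * (x\<^sup>2 - \<sigma>\<^sup>2)\<^sup>2 = normal_density 0 \<sigma> x * x ^ 4
        - 2 * \<sigma>\<^sup>2 * (normal_density 0 \<sigma> x * x ^ 2) + \<sigma> ^ 4 * (normal_density 0 \<sigma> x * x ^ 0)" for x
      by (simp add: power2_eq_square power4_eq_xxxx algebra_simps)
    moreover have "integrable lborel (\<lambda>x. normal_density 0 \<sigma> x * x ^ 4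
        - 2 * \<sigma>\<^sup>2 * (normal_density 0 \<sigma> x * x ^ 2) + \<sigma> ^ 4 * (normal_density 0 \<sigma> x * x ^ 0))"
      by (intro Bochner_Integration.integrable_add Bochner_Integration.integrable_diff
          integrable_mult_right integrable_normal_power)
    ultimately have int: "integrable lborel (\<lambda>x. normal_density 0 \<sigma> x * (x\<^sup>2 - \<sigma>\<^sup>2)\<^sup>2)"
      by simp
    have "(\<integral>x. normal_density 0 \<sigma> x * (x\<^sup>2 - \<sigma>\<^sup>2) \<partial>lborel)
        = (\<integral>x. normal_density 0 \<sigma> x * x\<^sup>2 - \<sigma>\<^sup>2 * (normal_density 0 \<sigma> x * x ^ 0) \<partial>lborel)"
      by (simp add: algebra_simps)
    also have "\<dots> = (\<integral>x. normal_density 0 \<sigma> x * x\<^sup>2 \<partial>lborel) - \<sigma>\<^sup>2 * (\<integral>x. normal_density 0 \<bar>\<sigma>\<bar> x \<partial>lborel)"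
      using integrable_normal_power[of 0]
      by (subst Bochner_Integration.integral_diff) (auto intro: sq simp: normal_density_abs)
    also have "\<dots> = 0"
      using integral_normal_density[OF sigma_abs] by (simp add: normal_second_moment)
    \<comment> \<open>The centering constant is written as an added term so that linearity of the
      tree mean splits it off.\<close>
    finally have "AE \<omega> in M. (\<lambda>r. tree_mean r (\<lambda>i. (\<epsilon> (2 * i + e) \<omega>)\<^sup>2 + - \<sigma>\<^sup>2)) \<longlonglongrightarrow> 0"
      using unweighted[OF e, of "\<lambda>x. x\<^sup>2 - \<sigma>\<^sup>2"] int by simp
    then show ?thesis
      unfolding tree_mean_linear by eventually_elim (simp add: LIM_zero_iff)
  qed
  have cross: "AE \<omega> in M. (\<lambda>r. tree_mean r (\<lambda>i. X i \<omega> * \<epsilon> (2 * i + e) \<omega>)) \<longlonglongrightarrow> 0"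
    if "e \<in> {0, 1}" for e
    using weighted_noise_tree_mean_tendsto_0[OF that, of "\<lambda>x. x" X C]
      normal_mean sq determined_by_X X_rv C by simp
  \<comment> \<open>Countably many vertices allow one null set for all recursion identities.\<close>
  have even: "AE \<omega> in M. \<forall>n\<ge>1. X (2 * n) \<omega> = \<alpha>0 * X n \<omega> + \<beta>0 + \<epsilon> (2 * n) \<omega>"
    and odd: "AE \<omega> in M. \<forall>n\<ge>1. X (2 * n + 1) \<omega> = \<alpha>1 * X n \<omega> + \<beta>1 + \<epsilon> (2 * n + 1) \<omega>"
    unfolding AE_all_countable using X_even X_odd by (auto intro: AE_impI)
  show ?thesis
    using even odd noise[of 0, simplified] noise[of 1, simplified] noise_sq[of 0, simplified]
      noise_sq[of 1, simplified] cross[of 0, simplified] cross[of 1, simplified]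
  proof eventually_elim
    case (elim \<omega>)
    interpret bar_path \<alpha>0 \<beta>0 \<alpha>1 \<beta>1 "\<sigma>\<^sup>2" "\<lambda>i. X i \<omega>" "\<lambda>i. \<epsilon> i \<omega>"
    proof
      show "\<bar>\<alpha>0\<bar> < 1" "\<bar>\<alpha>1\<bar> < 1" "\<sigma>\<^sup>2 > 0"
        using alpha0 alpha1 sigma by (simp_all add: abs_less_iff)
    next
      fix n :: nat assume "n \<ge> 1"
      then show "X (2 * n) \<omega> = \<alpha>0 * X n \<omega> + \<beta>0 + \<epsilon> (2 * n) \<omega>"
        "X (2 * n + 1) \<omega> = \<alpha>1 * X n \<omega> + \<beta>1 + \<epsilon> (2 * n + 1) \<omega>"
        using elim(1,2) by blast+
    next
      fix e :: nat assume "e \<in> {0, 1}"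
      then consider "e = 0" | "e = 1" by blast
      then show "(\<lambda>r. tree_mean r (\<lambda>i. \<epsilon> (2 * i + e) \<omega>)) \<longlonglongrightarrow> 0"
        "(\<lambda>r. tree_mean r (\<lambda>i. (\<epsilon> (2 * i + e) \<omega>)\<^sup>2)) \<longlonglongrightarrow> \<sigma>\<^sup>2"
        "(\<lambda>r. tree_mean r (\<lambda>i. X i \<omega> * \<epsilon> (2 * i + e) \<omega>)) \<longlonglongrightarrow> 0"
        using elim(3-8) by (cases; simp)+
    qed
    show ?case by (rule theta_hat_tendsto)
  qed
qed

end

theorem proposition31:
  fixes M :: "'a measure" and \<nu> :: "real measure"
    and \<alpha>0 \<beta>0 \<alpha>1 \<beta>1 \<sigma> \<rho> :: real
    and X \<epsilon> :: "nat \<Rightarrow> 'a \<Rightarrow> real"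
    and d :: "nat \<Rightarrow> 'a \<Rightarrow> real \<times> real \<times> real \<times> real"
  assumes "bar_model M \<nu> \<alpha>0 \<beta>0 \<alpha>1 \<beta>1 \<sigma> \<rho> X \<epsilon>"
    and "\<And>k::nat. integrable \<nu> (\<lambda>x. \<bar>x\<bar> ^ k)"
  shows "AE \<omega> in M. (\<lambda>r. theta_hat (d r \<omega>) r (\<lambda>i. X i \<omega>)) \<longlonglongrightarrow> (\<alpha>0, \<beta>0, \<alpha>1, \<beta>1)"
proof -
  interpret bar_model M \<nu> \<alpha>0 \<beta>0 \<alpha>1 \<beta>1 \<sigma> \<rho> X \<epsilon> by fact
  \<comment> \<open>The moment of order 2 of \<open>\<nu>\<close> becomes the second moment of the
    ancestor.\<close>
  have "integrable (distr M borel (X 1)) (\<lambda>x. x\<^sup>2)"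
    unfolding X_1 using assms(2)[of 2] by simp
  then have "integrable M (\<lambda>\<omega>. (X 1 \<omega>)\<^sup>2)"
    using X_rv[of 1] by (simp add: integrable_distr_eq)
  then show ?thesis by (rule theta_hat_tendsto_AE)
qed

end
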